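(* Let $p$ be a prime and let $n,m\ge 1$ be integers. There exist infinitely many pairwise non-isomorphic finite graphs $G$ such that $\mathrm{MH}_{3,2n+3}(G)$ contains a subgroup isomorphic to $\mathbb{Z}_{p^m}$.
   Context: All graphs are finite, undirected, with no loops and no multiple edges. For a graph $G$, $d(x,y)$ denotes the shortest-path distance (edges have length $1$; $\infty$ if no path). A $k$-path is a tuple $(x_0,\dots,x_k)$ of vertices with $x_i\neq x_{i+1}$ and $d(x_i,x_{i+1})<\infty$; its length is $\sum_i d(x_i,x_{i+1})$. $\mathrm{MC}_{k,\ell}(G)$ is the free abelian group on $k$-paths of length $\ell$, with differential $\partial=\sum_{i=1}^{k-1}(-1)^i\partial_i$, where $\partial_i$ deletes $x_i$ if the resulting tuple is a $(k-1)$-path of the same length $\ell$ and is $0$ otherwise; $\mathrm{MH}_{k,\ell}(G)=H_k(\mathrm{MC}_{*,\ell}(G))$. *)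

theory Defs
  imports
    "HOL-Computational_Algebra.Primes"
    "HOL-Algebra.Free_Abelian_Groups"
    "Graph_Theory.Pair_Digraph"
    "Graph_Theory.Shortest_Path"
    "Graph_Theory.Digraph_Isomorphism"
begin

text \<open>
  A finite simple undirected graph is a \<^locale>\<open>pair_graph\<close>: a finite set of vertices with a
  symmetric, irreflexive set of arcs, the edge \<open>{u, v}\<close> being the pair of arcs \<open>(u, v)\<close>, \<open>(v, u)\<close>.
  The definitions below are meant for such \<open>G\<close> only.
\<close>

definition graph_dist :: "'a pair_pre_digraph \<Rightarrow> 'a \<Rightarrow> 'a \<Rightarrow> ereal" where
  "graph_dist G u v = wf_digraph.\<mu> (with_proj G) (\<lambda>_. 1) u v"

definition graph_iso :: "'a pair_pre_digraph \<Rightarrow> 'b pair_pre_digraph \<Rightarrow> bool" where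
  "graph_iso G H \<longleftrightarrow> digraph_iso (with_proj G) (with_proj H)"

text \<open>The \<open>k\<close>-path \<open>(x\<^sub>0, \<dots>, x\<^sub>k)\<close> is the list \<open>[x\<^sub>0, \<dots>, x\<^sub>k]\<close> of length \<open>k + 1\<close>.\<close>

definition k_paths :: "'a pair_pre_digraph \<Rightarrow> nat \<Rightarrow> 'a list set" where
  "k_paths G k = {xs. length xs = Suc k \<and> set xs \<subseteq> pverts G \<and>
     (\<forall>i<k. xs ! i \<noteq> xs ! Suc i \<and> graph_dist G (xs ! i) (xs ! Suc i) < \<infinity>)}"

definition path_length :: "'a pair_pre_digraph \<Rightarrow> 'a list \<Rightarrow> ereal" where
  "path_length G xs = (\<Sum>i<length xs - 1. graph_dist G (xs ! i) (xs ! Suc i))"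

definition k_paths_of_length :: "'a pair_pre_digraph \<Rightarrow> nat \<Rightarrow> nat \<Rightarrow> 'a list set" where
  "k_paths_of_length G k l = {xs \<in> k_paths G k. path_length G xs = ereal (real l)}"

definition delete_nth :: "nat \<Rightarrow> 'a list \<Rightarrow> 'a list" where
  "delete_nth i xs = take i xs @ drop (Suc i) xs"

definition MC :: "'a pair_pre_digraph \<Rightarrow> nat \<Rightarrow> nat \<Rightarrow> ('a list \<Rightarrow>\<^sub>0 int) monoid" where
  "MC G k l = free_Abelian_group (k_paths_of_length G k l)"

definition mag_face :: "'a pair_pre_digraph \<Rightarrow> nat \<Rightarrow> nat \<Rightarrow> nat \<Rightarrow> 'a list \<Rightarrow> ('a list \<Rightarrow>\<^sub>0 int)" where
  "mag_face G k l i xs =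
     (if delete_nth i xs \<in> k_paths_of_length G (k - 1) l then frag_of (delete_nth i xs) else 0)"

text \<open>
  The differential from degree \<open>k\<close> to degree \<open>k - 1\<close>. For \<open>k = 0\<close> the sum is empty, so
  the map is zero and the truncated \<open>k - 1\<close> in the face maps is never reached.
\<close>

definition mag_diff ::
    "'a pair_pre_digraph \<Rightarrow> nat \<Rightarrow> nat \<Rightarrow> ('a list \<Rightarrow>\<^sub>0 int) \<Rightarrow> ('a list \<Rightarrow>\<^sub>0 int)" where
  "mag_diff G k l = frag_extend (\<lambda>xs. \<Sum>i = 1..<k. frag_cmul ((-1) ^ i) (mag_face G k l i xs))"

definition mag_cycles :: "'a pair_pre_digraph \<Rightarrow> nat \<Rightarrow> nat \<Rightarrow> ('a list \<Rightarrow>\<^sub>0 int) set" where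
  "mag_cycles G k l = {c \<in> carrier (MC G k l). mag_diff G k l c = 0}"

definition mag_boundaries :: "'a pair_pre_digraph \<Rightarrow> nat \<Rightarrow> nat \<Rightarrow> ('a list \<Rightarrow>\<^sub>0 int) set" where
  "mag_boundaries G k l = mag_diff G (Suc k) l ` carrier (MC G (Suc k) l)"

definition MH :: "'a pair_pre_digraph \<Rightarrow> nat \<Rightarrow> nat \<Rightarrow> ('a list \<Rightarrow>\<^sub>0 int) set monoid" where
  "MH G k l = subgroup_generated (MC G k l) (mag_cycles G k l) Mod mag_boundaries G k l"

end

theory Submission
  imports Defs "HOL-Library.Countable"
begin

text \<open>
  If all edges of a graph change a level function by exactly one and \<open>d(a, z)\<close> is the difference of
  the levels of \<open>z\<close> and \<open>a\<close>, then the \<open>k\<close>-paths of length \<open>d(a, z)\<close> from \<open>a\<close> to \<open>z\<close> are the chains of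
  the poset of upward walks, and their magnitude complex is the order complex of the open interval
  \<open>(a, z)\<close>, shifted by two. For the interval we take the face poset of a disc glued to a circle along a
  map of degree \<open>N = p\<^sup>m\<close>. The circle gives a cycle \<open>\<zeta>\<close> in degree 3, and \<open>N \<zeta>\<close> is the boundary of the
  disc. Conversely, a cochain that is a cocycle modulo \<open>N\<close> and has the value 1 on \<open>\<zeta>\<close> shows that
  \<open>i \<zeta>\<close> is a boundary only if \<open>N\<close> divides \<open>i\<close>.
\<close>

section \<open>Torsion classes in magnitude homology\<close>

text \<open>Powers of \<open>x\<close> agree iff \<open>N\<close> divides the difference of the
  exponents, so exponentiation is well defined and injective on residues modulo
  \<open>N\<close>.\<close>

lemma (in group) range_int_pow_iso_integer_mod_group:
  assumes x: "x \<in> carrier G" and N: "N > 0"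
    and order: "\<And>k::int. x [^] k = \<one> \<longleftrightarrow> int N dvd k"
  shows "G\<lparr>carrier := range (\<lambda>k::int. x [^] k)\<rparr> \<cong> integer_mod_group N"
proof -
  let ?H = "G\<lparr>carrier := range (\<lambda>k::int. x [^] k)\<rparr>"
  have pow_eq: "x [^] i = x [^] j \<longleftrightarrow> int N dvd i - j" for i j :: int
  proof -
    have "x [^] i = x [^] j \<longleftrightarrow> x [^] (i - j) = \<one>"
      using x inv_equality[of "x [^] i" "inv (x [^] j)"] by (auto simp: int_pow_diff)
    then show ?thesis by (simp add: order)
  qed
  have mod_eq: "x [^] (i mod int N) = x [^] i" for i :: int
    by (simp add: pow_eq dvd_eq_mod_eq_0 mod_diff_left_eq)
  have "(\<lambda>k. x [^] k) \<in> iso (integer_mod_group N) ?H"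
  proof (rule isoI)
    show "(\<lambda>k. x [^] k) \<in> hom (integer_mod_group N) ?H"
      by (rule homI) (auto simp: mod_eq int_pow_mult x)
    show "bij_betw (\<lambda>k. x [^] k) (carrier (integer_mod_group N)) (carrier ?H)"
    proof (rule bij_betwI')
      fix i j assume "i \<in> carrier (integer_mod_group N)" "j \<in> carrier (integer_mod_group N)"
      then have ij: "0 \<le> i" "i < int N" "0 \<le> j" "j < int N"
        using N by (auto simp: carrier_integer_mod_group)
      show "x [^] i = x [^] j \<longleftrightarrow> i = j"
        using ij by (auto simp: pow_eq mod_eq_dvd_iff[symmetric])
    next
      fix y assume "y \<in> carrier ?H"
      then obtain k :: int where "y = x [^] k" by auto
      then show "\<exists>i\<in>carrier (integer_mod_group N). y = x [^] i"
        using N by (intro bexI[of _ "k mod int N"]) (auto simp: mod_eq carrier_integer_mod_group)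
    qed simp
  qed
  then have "integer_mod_group N \<cong> ?H" by (auto simp: is_iso_def)
  then show ?thesis by (rule group.iso_sym[OF group_integer_mod_group])
qed

section \<open>Supports of chains and linearity of the differential\<close>

lemma keys_frag_extend_subset:
  assumes "\<And>x. x \<in> Poly_Mapping.keys c \<Longrightarrow> Poly_Mapping.keys (f x) \<subseteq> S"
  shows "Poly_Mapping.keys (frag_extend f c) \<subseteq> S"
  using keys_frag_extend[of f c] assms by blast

lemma keys_frag_add_subset:
  "Poly_Mapping.keys a \<subseteq> S \<Longrightarrow> Poly_Mapping.keys b \<subseteq> S \<Longrightarrow> Poly_Mapping.keys (a + b) \<subseteq> S"
  by (rule order_trans[OF keys_add Un_least])

lemma keys_frag_diff_subset:
  "Poly_Mapping.keys a \<subseteq> S \<Longrightarrow> Poly_Mapping.keys b \<subseteq> S \<Longrightarrow> Poly_Mapping.keys (a - b) \<subseteq> S"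
  by (rule order_trans[OF keys_diff Un_least])

lemma keys_frag_sum_subset:
  "(\<And>i. i \<in> I \<Longrightarrow> Poly_Mapping.keys (f i) \<subseteq> S) \<Longrightarrow> Poly_Mapping.keys (sum f I) \<subseteq> S"
  by (induction I rule: infinite_finite_induct) (simp_all add: keys_frag_add_subset)

lemma keys_mag_diff:
  "Poly_Mapping.keys (mag_diff G k l c) \<subseteq> k_paths_of_length G (k - 1) l"
  unfolding mag_diff_def
  by (intro keys_frag_extend_subset keys_frag_sum_subset order_trans[OF keys_cmul])
     (simp add: mag_face_def)

lemma mag_diff_diff: "mag_diff G k l (c - d) = mag_diff G k l c - mag_diff G k l d"
  by (simp add: mag_diff_def frag_extend_diff)

lemma mag_diff_add: "mag_diff G k l (c + d) = mag_diff G k l c + mag_diff G k l d"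
  by (simp add: mag_diff_def frag_extend_add)

lemma mag_diff_cmul: "mag_diff G k l (frag_cmul a c) = frag_cmul a (mag_diff G k l c)"
  by (simp add: mag_diff_def frag_extend_cmul)

lemma mag_diff_0 [simp]: "mag_diff G k l 0 = 0"
  by (simp add: mag_diff_def)

lemma mag_diff_sum: "finite I \<Longrightarrow> mag_diff G k l (sum f I) = (\<Sum>i\<in>I. mag_diff G k l (f i))"
  by (simp add: mag_diff_def frag_extend_sum)

lemma subgroup_mag_cycles: "subgroup (mag_cycles G k l) (MC G k l)"
proof -
  interpret comm_group "MC G k l" unfolding MC_def by (rule abelian_free_Abelian_group)
  show ?thesis
    by (rule group.subgroupI)
       (auto simp: mag_cycles_def MC_def mag_diff_add mag_diff_diff[of G k l 0, simplified]
          intro!: exI[of _ 0] dest!: subsetD[OF keys_add])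
qed

lemma subgroup_mag_boundaries: "subgroup (mag_boundaries G k l) (MC G k l)"
proof -
  interpret comm_group "MC G k l" unfolding MC_def by (rule abelian_free_Abelian_group)
  let ?D = "mag_diff G (Suc k) l"
  have keys: "Poly_Mapping.keys (?D c) \<subseteq> k_paths_of_length G k l" for c
    using keys_mag_diff[of G "Suc k" l c] by simp
  show ?thesis
  proof (rule subgroupI)
    show "inv\<^bsub>MC G k l\<^esub> a \<in> mag_boundaries G k l" if "a \<in> mag_boundaries G k l" for a
    proof -
      from that obtain c where "Poly_Mapping.keys c \<subseteq> k_paths_of_length G (Suc k) l" "a = ?D c"
        by (auto simp: mag_boundaries_def MC_def)
      then show ?thesis
        unfolding mag_boundaries_def
        by (intro image_eqI[of _ _ "- c"])
           (auto simp: keys MC_def mag_diff_diff[of G "Suc k" l 0, simplified])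
    qed
    show "a \<otimes>\<^bsub>MC G k l\<^esub> b \<in> mag_boundaries G k l"
      if "a \<in> mag_boundaries G k l" "b \<in> mag_boundaries G k l" for a b
    proof -
      from that obtain c d where "Poly_Mapping.keys c \<subseteq> k_paths_of_length G (Suc k) l" "a = ?D c"
        "Poly_Mapping.keys d \<subseteq> k_paths_of_length G (Suc k) l" "b = ?D d"
        by (auto simp: mag_boundaries_def MC_def)
      then show ?thesis
        unfolding mag_boundaries_def
        by (intro image_eqI[of _ _ "c + d"]) (auto simp: MC_def mag_diff_add dest!: subsetD[OF keys_add])
    qed
    show "mag_boundaries G k l \<noteq> {}"
      using subgroup.one_closed[OF subgroup_mag_cycles, of G "Suc k" l]
      by (auto simp: mag_boundaries_def mag_cycles_def)
  qed (use keys in \<open>auto simp: mag_boundaries_def MC_def\<close>)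
qed

text \<open>
  This description of \<^const>\<open>MH\<close> only uses that the cycles and the boundaries are subgroups of the
  chains, so that \<open>\<partial>\<partial> = 0\<close> is never needed.
\<close>

lemma MH_eq_subgroup_of_quotient:
  "MH G k l = (MC G k l Mod mag_boundaries G k l)
     \<lparr>carrier := (\<lambda>c. mag_boundaries G k l #>\<^bsub>MC G k l\<^esub> c) ` mag_cycles G k l\<rparr>"
proof -
  have "carrier (subgroup_generated (MC G k l) (mag_cycles G k l)) = mag_cycles G k l"
    by (rule subgroup.carrier_subgroup_generated_subgroup[OF subgroup_mag_cycles])
  \<comment> \<open>Cosets and set products depend only on the multiplication, which
    \<open>subgroup_generated\<close> keeps.\<close>
  moreover have "r_coset (subgroup_generated (MC G k l) A) = r_coset (MC G k l)"
    "set_mult (subgroup_generated (MC G k l) A) = set_mult (MC G k l)" for A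
    by (simp_all add: fun_eq_iff r_coset_def set_mult_def)
  ultimately show ?thesis
    by (simp add: MH_def FactGroup_def RCOSETS_def UNION_singleton_eq_range)
qed

text \<open>The linear extension of a cochain. As \<open>frag_extend\<close> takes values in free
  abelian groups, the integers appear as the one on the single generator \<open>()\<close>.\<close>

definition frag_eval :: "('a \<Rightarrow> int) \<Rightarrow> ('a \<Rightarrow>\<^sub>0 int) \<Rightarrow> int" where
  "frag_eval \<phi> c = Poly_Mapping.lookup (frag_extend (\<lambda>x. frag_cmul (\<phi> x) (frag_of ())) c) ()"

lemma frag_eval_simps [simp]:
  "frag_eval \<phi> 0 = 0"
  "frag_eval \<phi> (frag_of x) = \<phi> x"
  "frag_eval \<phi> (a + b) = frag_eval \<phi> a + frag_eval \<phi> b"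
  "frag_eval \<phi> (- a) = - frag_eval \<phi> a"
  "frag_eval \<phi> (a - b) = frag_eval \<phi> a - frag_eval \<phi> b"
  "frag_eval \<phi> (frag_cmul k a) = k * frag_eval \<phi> a"
  by (simp_all add: frag_eval_def frag_extend_add frag_extend_diff frag_extend_minus
      frag_extend_cmul lookup_add lookup_minus)

text \<open>The class of \<open>z\<close> has order exactly \<open>N\<close>: \<open>c\<close>
  bounds its \<open>N\<close>-fold multiple, while \<phi> maps \<open>frag_cmul i z\<close> to
  \<open>i\<close> and all boundaries to multiples of \<open>N\<close>.\<close>

lemma MH_torsion:
  assumes z: "z \<in> mag_cycles G k l" and N: "N > 0"
    and c: "c \<in> carrier (MC G (Suc k) l)" "mag_diff G (Suc k) l c = frag_cmul (int N) z"
    and cocycle: "\<And>xs. xs \<in> k_paths_of_length G (Suc k) l \<Longrightarrow>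
      int N dvd frag_eval \<phi> (mag_diff G (Suc k) l (frag_of xs))"
    and \<phi>z: "frag_eval \<phi> z = 1"
  shows "\<exists>T. subgroup T (MH G k l) \<and> (MH G k l)\<lparr>carrier := T\<rparr> \<cong> integer_mod_group N"
proof -
  let ?C = "MC G k l" and ?B = "mag_boundaries G k l"
  let ?q = "\<lambda>c. ?B #>\<^bsub>?C\<^esub> c"
  interpret C: comm_group ?C unfolding MC_def by (rule abelian_free_Abelian_group)
  interpret B: normal ?B ?C by (rule C.subgroup_imp_normal[OF subgroup_mag_boundaries])
  interpret Q: group "?C Mod ?B" by (rule B.factorgroup_is_group)
  interpret q: group_hom ?C "?C Mod ?B" ?q
    by unfold_locales (rule B.r_coset_hom_Mod)
  interpret Z: subgroup "mag_cycles G k l" ?C by (rule subgroup_mag_cycles)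
  have zC: "z \<in> carrier ?C" using z by (rule Z.mem_carrier)
  then have keys_z: "Poly_Mapping.keys z \<subseteq> k_paths_of_length G k l" by (simp add: MC_def)
  have pow_z: "z [^]\<^bsub>?C\<^esub> i = frag_cmul i z" for i :: int
    using keys_z by (simp add: MC_def)
  have eval_dvd: "int N dvd frag_eval \<phi> (mag_diff G (Suc k) l d)"
    if "Poly_Mapping.keys d \<subseteq> k_paths_of_length G (Suc k) l" for d
    using that by (induction d rule: frag_induction) (auto simp: mag_diff_diff intro: cocycle)
  have "frag_cmul i z \<in> ?B \<longleftrightarrow> int N dvd i" for i
  proof
    assume "frag_cmul i z \<in> ?B"
    then obtain d where "Poly_Mapping.keys d \<subseteq> k_paths_of_length G (Suc k) l"
      "frag_cmul i z = mag_diff G (Suc k) l d"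
      by (auto simp: mag_boundaries_def MC_def)
    then show "int N dvd i"
      using eval_dvd[of d] \<phi>z frag_eval_simps(6)[of \<phi> i z] by simp
  next
    assume "int N dvd i"
    then obtain j where "i = j * int N" by (metis dvdE mult.commute)
    then have "frag_cmul i z = mag_diff G (Suc k) l (frag_cmul j c)"
      by (simp add: mag_diff_cmul c)
    moreover have "frag_cmul j c \<in> carrier (MC G (Suc k) l)"
      using c(1) order_trans[OF keys_cmul] by (auto simp: MC_def)
    ultimately show "frag_cmul i z \<in> ?B" by (auto simp: mag_boundaries_def)
  qed
  moreover have "?q z [^]\<^bsub>?C Mod ?B\<^esub> i = \<one>\<^bsub>?C Mod ?B\<^esub> \<longleftrightarrow> frag_cmul i z \<in> ?B" for i :: int
  proof -
    have "?q z [^]\<^bsub>?C Mod ?B\<^esub> i = ?q (frag_cmul i z)"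
      using q.hom_int_pow[OF zC, of i] by (simp add: pow_z)
    moreover have "frag_cmul i z \<in> carrier ?C"
      using C.int_pow_closed[OF zC, of i] by (simp add: pow_z)
    ultimately show ?thesis
      using C.coset_join1[OF _ _ subgroup_mag_boundaries] B.rcos_const[OF C.is_group]
      by (auto simp: FactGroup_def)
  qed
  ultimately have order: "?q z [^]\<^bsub>?C Mod ?B\<^esub> i = \<one>\<^bsub>?C Mod ?B\<^esub> \<longleftrightarrow> int N dvd i" for i :: int
    by blast
  let ?T = "range (\<lambda>i::int. ?q z [^]\<^bsub>?C Mod ?B\<^esub> i)"
  have qz: "?q z \<in> carrier (?C Mod ?B)" using zC by (rule q.hom_closed)
  \<comment> \<open>Powers are taken in the quotient of all chains; multiples of \<open>z\<close>
    are cycles, so their classes stay in the subgroup that is the homology.\<close>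
  have T_sub: "?T \<subseteq> ?q ` mag_cycles G k l"
  proof clarify
    fix i :: int
    have "?q z [^]\<^bsub>?C Mod ?B\<^esub> i = ?q (z [^]\<^bsub>?C\<^esub> i)"
      using zC by (simp add: q.hom_int_pow)
    then show "?q z [^]\<^bsub>?C Mod ?B\<^esub> i \<in> ?q ` mag_cycles G k l"
      using C.subgroup_int_pow_closed[OF subgroup_mag_cycles z] by auto
  qed
  have "subgroup ?T (?C Mod ?B)"
    using qz by (rule Q.subgroup_of_powers)
  moreover have "subgroup (?q ` mag_cycles G k l) (?C Mod ?B)"
    by (rule q.subgroup_img_is_subgroup[OF subgroup_mag_cycles])
  ultimately have "subgroup ?T (MH G k l)"
    unfolding MH_eq_subgroup_of_quotient using T_sub by (rule Q.subgroup_incl)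
  moreover have "(MH G k l)\<lparr>carrier := ?T\<rparr> \<cong> integer_mod_group N"
    using Q.range_int_pow_iso_integer_mod_group[OF qz N order]
    by (simp add: MH_eq_subgroup_of_quotient)
  ultimately show ?thesis by blast
qed

section \<open>Geodesics in layered graphs\<close>

lemma mag_diff_3_frag_of:
  "mag_diff G 3 l (frag_of xs) = mag_face G 3 l 2 xs - mag_face G 3 l 1 xs"
proof -
  have "{1..<3} = {1, 2 :: nat}" by auto
  then show ?thesis unfolding mag_diff_def by simp
qed

lemma mag_diff_4_frag_of:
  "mag_diff G 4 l (frag_of xs) = mag_face G 4 l 2 xs - mag_face G 4 l 1 xs - mag_face G 4 l 3 xs"
proof -
  have "{1..<4} = {1, 2, 3 :: nat}" by auto
  then show ?thesis unfolding mag_diff_def by simp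
qed

text \<open>By \<open>lev_ends\<close>, \<open>l\<close> is the least length that the levels allow
  for a path from \<open>a\<close> to \<open>z\<close>.\<close>

locale layered_graph = pair_graph G for G :: "'a pair_pre_digraph" +
  fixes lev :: "'a \<Rightarrow> int" and a z :: 'a and l :: nat
  assumes lev_arc: "(u, v) \<in> parcs G \<Longrightarrow> \<bar>lev v - lev u\<bar> = 1"
    and a_in_verts: "a \<in> pverts G"
    and lev_ends: "lev z - lev a = int l"
begin

definition up :: "'a rel" where
  "up = {(u, v) \<in> parcs G. lev v = lev u + 1}"

lemma awalk_cost_unit: "awalk_cost (\<lambda>_. 1) p = real (length p)"
  by (induction p) auto

lemma lev_le_length_awalk: "awalk u p v \<Longrightarrow> lev v - lev u \<le> int (length p)"
proof (induction p arbitrary: u)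
  case (Cons e p)
  then have "lev v - lev (snd e) \<le> int (length p)" "(u, snd e) \<in> parcs G"
    by (auto simp: awalk_Cons_iff)
  then show ?case using lev_arc[of u "snd e"] by simp
qed (auto simp: awalk_Nil_iff)

text \<open>No step gains more than one level, so a walk as long as its total gain rises at every
  step.\<close>

lemma up_rtrancl_if_awalk:
  "awalk u p v \<Longrightarrow> lev v - lev u = int (length p) \<Longrightarrow> (u, v) \<in> up\<^sup>*"
proof (induction p arbitrary: u)
  case (Cons e p)
  then have *: "awalk (snd e) p v" "(u, snd e) \<in> parcs G"
    by (auto simp: awalk_Cons_iff)
  then have "lev (snd e) = lev u + 1" "lev v - lev (snd e) = int (length p)"
    using Cons.prems(2) lev_le_length_awalk[OF *(1)] lev_arc[OF *(2)] by auto
  then have "(u, snd e) \<in> up" "(snd e, v) \<in> up\<^sup>*"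
    using * Cons.IH by (auto simp: up_def)
  then show ?case by (rule converse_rtrancl_into_rtrancl)
qed (auto simp: awalk_Nil_iff)

lemma awalk_if_up_rtrancl:
  assumes "(u, v) \<in> up\<^sup>*" "v \<in> pverts G"
  shows "\<exists>p. awalk u p v \<and> lev v - lev u = int (length p)"
  using assms(1)
proof (induction rule: converse_rtrancl_induct)
  case base
  then show ?case using assms(2) by (intro exI[of _ "[]"]) (auto simp: awalk_Nil_iff)
next
  case (step u w)
  then obtain p where "awalk w p v" "lev v - lev w = int (length p)" by blast
  then show ?case using step.hyps(1)
    by (intro exI[of _ "(u, w) # p"]) (auto simp: awalk_Cons_iff up_def)
qed

lemma lev_le_graph_dist: "ereal (real_of_int (lev v - lev u)) \<le> graph_dist G u v"
  unfolding graph_dist_def \<mu>_def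
  using lev_le_length_awalk of_int_le_iff[where 'a = real]
  by (intro INF_greatest) (fastforce simp: awalk_cost_unit)

lemma graph_dist_eq_lev_iff:
  assumes "v \<in> pverts G"
  shows "graph_dist G u v = ereal (real_of_int (lev v - lev u)) \<longleftrightarrow> (u, v) \<in> up\<^sup>*"
proof
  assume "(u, v) \<in> up\<^sup>*"
  then obtain p where p: "awalk u p v" "lev v - lev u = int (length p)"
    using awalk_if_up_rtrancl assms by blast
  have "graph_dist G u v \<le> ereal (real_of_int (lev v - lev u))"
    unfolding graph_dist_def using min_cost_le_walk_cost[OF p(1), of "\<lambda>_. 1"] p(2)
    by (simp add: awalk_cost_unit)
  then show "graph_dist G u v = ereal (real_of_int (lev v - lev u))"
    using lev_le_graph_dist[of v u] by (rule antisym)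
next
  assume eq: "graph_dist G u v = ereal (real_of_int (lev v - lev u))"
  show "(u, v) \<in> up\<^sup>*"
  proof (rule ccontr)
    assume "(u, v) \<notin> up\<^sup>*"
    \<comment> \<open>Levels are integers, so every walk is too long by at least one, and this gap
      survives in the infimum.\<close>
    then have "lev v - lev u + 1 \<le> int (length p)" if "awalk u p v" for p
      using lev_le_length_awalk[OF that] up_rtrancl_if_awalk[OF that] by linarith
    then have "real_of_int (lev v - lev u + 1) \<le> real (length p)" if "awalk u p v" for p
      using that by (metis of_int_le_iff of_int_of_nat_eq)
    then have "ereal (real_of_int (lev v - lev u + 1)) \<le> graph_dist G u v"
      unfolding graph_dist_def \<mu>_def
      by (intro INF_greatest) (simp add: awalk_cost_unit)
    with eq show False by simp
  qed
qed

lemma lev_less_if_up_trancl: "(u, v) \<in> up\<^sup>+ \<Longrightarrow> lev u < lev v"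
  by (induction rule: trancl_induct) (auto simp: up_def)

lemma up_trancl_verts: "(u, v) \<in> up\<^sup>+ \<Longrightarrow> u \<in> pverts G \<and> v \<in> pverts G"
  by (induction rule: trancl_induct) (auto simp: up_def in_arcsD1 in_arcsD2)

text \<open>The level differences telescope to \<open>l\<close> and bound the distances from below,
  so total length \<open>l\<close> forces equality in each step.\<close>

lemma geodesic_iff_chain:
  assumes "length xs = Suc k" "xs ! 0 = a" "xs ! k = z"
  shows "xs \<in> k_paths_of_length G k l \<longleftrightarrow> (\<forall>i<k. (xs ! i, xs ! Suc i) \<in> up\<^sup>+)"
proof
  have tele: "(\<Sum>i<k. real_of_int (lev (xs ! Suc i) - lev (xs ! i))) = real l"
    using sum_lessThan_telescope[of "\<lambda>i. real_of_int (lev (xs ! i))" k] assms lev_ends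
    by simp
  let ?d = "\<lambda>i. graph_dist G (xs ! i) (xs ! Suc i)"
  {
    assume "xs \<in> k_paths_of_length G k l"
    then have verts: "set xs \<subseteq> pverts G" and ne: "\<And>i. i < k \<Longrightarrow> xs ! i \<noteq> xs ! Suc i"
      and fin: "\<And>i. i < k \<Longrightarrow> ?d i < \<infinity>" and len: "(\<Sum>i<k. ?d i) = ereal (real l)"
      using assms by (auto simp: k_paths_of_length_def k_paths_def path_length_def)
    \<comment> \<open>The distances are passed to the reals, where equal sums of termwise comparable
      summands have equal terms.\<close>
    define r where "r i = real_of_ereal (?d i)" for i
    have r: "?d i = ereal (r i)" if "i < k" for i
      using fin[OF that] lev_le_graph_dist[of "xs ! Suc i" "xs ! i"]
      by (cases "?d i") (auto simp: r_def)
    have sum_r: "(\<Sum>i<k. real_of_int (lev (xs ! Suc i) - lev (xs ! i))) = (\<Sum>i<k. r i)"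
      unfolding tele using len r by simp
    have le: "real_of_int (lev (xs ! Suc i) - lev (xs ! i)) \<le> r i" if "i \<in> {..<k}" for i
      using lev_le_graph_dist[of "xs ! Suc i" "xs ! i"] r[of i] that by simp
    have eq: "real_of_int (lev (xs ! Suc i) - lev (xs ! i)) = r i" if "i < k" for i
      by (rule sum_mono_inv[OF sum_r le]) (use that in simp_all)
    have "(xs ! i, xs ! Suc i) \<in> up\<^sup>*" if "i < k" for i
      using that r[OF that] verts assms(1) eq[OF that]
      by (subst graph_dist_eq_lev_iff[symmetric]) (auto simp: subset_iff simp del: of_int_diff)
    then show "\<forall>i<k. (xs ! i, xs ! Suc i) \<in> up\<^sup>+"
      using ne by (metis rtrancl_eq_or_trancl)
  }
  assume chain: "\<forall>i<k. (xs ! i, xs ! Suc i) \<in> up\<^sup>+"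
  have verts: "xs ! i \<in> pverts G" if "i < Suc k" for i
    using that chain up_trancl_verts a_in_verts assms(2) by (cases i) auto
  have d: "?d i = ereal (real_of_int (lev (xs ! Suc i) - lev (xs ! i)))" if "i < k" for i
    using that chain verts by (subst graph_dist_eq_lev_iff) (auto intro: trancl_into_rtrancl)
  have "(\<Sum>i<k. ?d i) = ereal (real l)"
    using tele by (simp add: d del: of_int_diff)
  moreover have "xs ! i \<noteq> xs ! Suc i" if "i < k" for i
    using chain lev_less_if_up_trancl that by fastforce
  moreover have "set xs \<subseteq> pverts G"
    using verts assms(1) by (auto simp: in_set_conv_nth)
  ultimately show "xs \<in> k_paths_of_length G k l"
    using assms d by (auto simp: k_paths_of_length_def k_paths_def path_length_def)
qed

section \<open>Chains and differentials in low degrees\<close>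

lemma geodesic_2_iff: "[a, x, z] \<in> k_paths_of_length G 2 l \<longleftrightarrow> (a, x) \<in> up\<^sup>+ \<and> (x, z) \<in> up\<^sup>+"
  by (subst geodesic_iff_chain) (auto simp: less_Suc_eq numeral_eq_Suc)

lemma geodesic_3_iff:
  "[a, x, y, z] \<in> k_paths_of_length G 3 l \<longleftrightarrow> (a, x) \<in> up\<^sup>+ \<and> (x, y) \<in> up\<^sup>+ \<and> (y, z) \<in> up\<^sup>+"
  by (subst geodesic_iff_chain) (auto simp: less_Suc_eq numeral_eq_Suc)

lemma geodesic_4_iff:
  "[a, w, x, y, z] \<in> k_paths_of_length G 4 l \<longleftrightarrow>
     (a, w) \<in> up\<^sup>+ \<and> (w, x) \<in> up\<^sup>+ \<and> (x, y) \<in> up\<^sup>+ \<and> (y, z) \<in> up\<^sup>+"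
  by (subst geodesic_iff_chain) (auto simp: less_Suc_eq numeral_eq_Suc)

text \<open>Deleting an inner entry of a chain leaves a chain, so no face vanishes.\<close>

lemma mag_diff_3:
  assumes "(a, x) \<in> up\<^sup>+" "(x, y) \<in> up\<^sup>+" "(y, z) \<in> up\<^sup>+"
  shows "mag_diff G 3 l (frag_of [a, x, y, z]) = frag_of [a, x, z] - frag_of [a, y, z]"
proof -
  have "(a, y) \<in> up\<^sup>+" "(x, z) \<in> up\<^sup>+" using assms by auto
  then show ?thesis
    using assms
    by (simp add: mag_diff_3_frag_of mag_face_def delete_nth_def geodesic_2_iff)
qed

lemma mag_diff_4:
  assumes "(a, w) \<in> up\<^sup>+" "(w, x) \<in> up\<^sup>+" "(x, y) \<in> up\<^sup>+" "(y, z) \<in> up\<^sup>+"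
  shows "mag_diff G 4 l (frag_of [a, w, x, y, z]) =
    frag_of [a, w, y, z] - frag_of [a, x, y, z] - frag_of [a, w, x, z]"
proof -
  have "(a, x) \<in> up\<^sup>+" "(w, y) \<in> up\<^sup>+" "(x, z) \<in> up\<^sup>+" using assms by auto
  then show ?thesis
    using assms
    by (simp add: mag_diff_4_frag_of mag_face_def delete_nth_def geodesic_3_iff)
qed

lemma cocycle_dvd:
  assumes cocycle: "\<And>w x y. (a, w) \<in> up\<^sup>+ \<Longrightarrow> (w, x) \<in> up\<^sup>+ \<Longrightarrow> (x, y) \<in> up\<^sup>+ \<Longrightarrow> (y, z) \<in> up\<^sup>+ \<Longrightarrow>
      N dvd \<psi> w x + \<psi> x y - \<psi> w y"
    and \<phi>: "\<And>xs. \<phi> xs = (if length xs = 4 \<and> xs ! 0 = a \<and> xs ! 3 = z then \<psi> (xs ! 1) (xs ! 2) else 0)"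
    and xs: "xs \<in> k_paths_of_length G 4 l"
  shows "N dvd frag_eval \<phi> (mag_diff G 4 l (frag_of xs))"
proof -
  from xs obtain x0 x1 x2 x3 x4 where eq: "xs = [x0, x1, x2, x3, x4]"
    by (auto simp: k_paths_of_length_def k_paths_def length_Suc_conv numeral_eq_Suc)
  show ?thesis
  proof (cases "x0 = a \<and> x4 = z")
    case True
    then have "(a, x1) \<in> up\<^sup>+" "(x1, x2) \<in> up\<^sup>+" "(x2, x3) \<in> up\<^sup>+" "(x3, z) \<in> up\<^sup>+"
      using xs eq geodesic_4_iff by auto
    then show ?thesis
      using True cocycle[of x1 x2 x3] dvd_minus_iff[of N "\<psi> x1 x2 + \<psi> x2 x3 - \<psi> x1 x3"]
      by (simp add: eq mag_diff_4 \<phi> algebra_simps)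
  next
    case False
    \<comment> \<open>Faces delete inner entries only, so the wrong endpoints persist and \<phi> is
      0 there.\<close>
    then have "frag_eval \<phi> (mag_face G 4 l i xs) = 0" if "i \<in> {1, 2, 3}" for i
      using that by (auto simp: mag_face_def eq delete_nth_def \<phi>)
    then show ?thesis
      by (simp add: mag_diff_4_frag_of)
  qed
qed

end

section \<open>A layered graph carrying a Moore space\<close>

text \<open>
  The disc is a \<open>2N\<close>-gon with centre \<open>Leg 2\<close>, cut by spokes into \<open>2N\<close> triangles \<open>Tri j\<close>, whose boundary is
  wrapped \<open>N\<close> times around the circle with vertices \<open>Leg 0\<close>, \<open>Leg 1\<close> and edges \<open>Arc 0\<close>, \<open>Arc 1\<close>. Each
  vertex of this complex is stretched to a chain \<open>Leg c 1, \<dots>, Leg c r\<close>, which has no effect on homology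
  but lets the distance from \<open>Source\<close> to \<open>Sink\<close> be any \<open>r + 3\<close>. The isolated vertices \<open>Extra i\<close> only
  serve to make the graphs pairwise non-isomorphic.
\<close>

datatype cell = Source | Sink | Leg nat nat | Arc nat | Spoke nat | Tri nat | Extra nat

instance cell :: countable
  by countable_datatype

context
  fixes N r :: nat
begin

text \<open>\<open>Spoke j\<close> joins the centre to the \<open>j\<close>-th polygon vertex, which
  maps to circle vertex \<open>j mod 2\<close>; \<open>Tri j\<close> lies between spokes
  \<open>j\<close> and \<open>j + 1\<close>, cyclically, over an edge that maps to
  \<open>Arc (j mod 2)\<close>.\<close>

inductive cover :: "cell \<Rightarrow> cell \<Rightarrow> bool" where
  "c < 3 \<Longrightarrow> cover Source (Leg c 1)"
| "c < 3 \<Longrightarrow> 1 \<le> i \<Longrightarrow> i < r \<Longrightarrow> cover (Leg c i) (Leg c (Suc i))"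
| "c < 2 \<Longrightarrow> d < 2 \<Longrightarrow> cover (Leg c r) (Arc d)"
| "j < 2 * N \<Longrightarrow> cover (Leg (j mod 2) r) (Spoke j)"
| "j < 2 * N \<Longrightarrow> cover (Leg 2 r) (Spoke j)"
| "j < 2 * N \<Longrightarrow> cover (Arc (j mod 2)) (Tri j)"
| "j < 2 * N \<Longrightarrow> cover (Spoke j) (Tri j)"
| "j < 2 * N \<Longrightarrow> cover (Spoke (Suc j mod (2 * N))) (Tri j)"
| "j < 2 * N \<Longrightarrow> cover (Tri j) Sink"

fun rank :: "cell \<Rightarrow> nat" where
  "rank Source = 0"
| "rank (Leg c i) = i"
| "rank (Arc d) = r + 1"
| "rank (Spoke j) = r + 1"
| "rank (Tri j) = r + 2"
| "rank Sink = r + 3"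
| "rank (Extra i) = 0"

definition cells :: "cell set" where
  "cells = {Source, Sink} \<union> case_prod Leg ` ({..<3} \<times> {1..r}) \<union> Arc ` {..<2}
     \<union> Spoke ` {..<2 * N} \<union> Tri ` {..<2 * N}"

text \<open>The undirected Hasse diagram plus \<open>k\<close> isolated vertices, encoded by
  \<open>to_nat\<close> so that all these graphs share one vertex type.\<close>

definition moore_graph :: "nat \<Rightarrow> nat pair_pre_digraph" where
  "moore_graph k = \<lparr>pverts = to_nat ` (cells \<union> Extra ` {..<k}),
     parcs = {(to_nat x, to_nat y) | x y. cover x y \<or> cover y x}\<rparr>"

section \<open>Upward walks as chains of the cell poset\<close>

lemma rank_cover: "cover x y \<Longrightarrow> rank y = Suc (rank x)"
  by (induction rule: cover.induct) auto

lemma finite_cells: "finite cells"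
  by (simp add: cells_def)

lemma cover_cells:
  assumes "r \<ge> 1" "cover x y"
  shows "x \<in> cells \<and> y \<in> cells"
proof -
  have "Suc j mod (2 * N) < 2 * N" if "j < 2 * N" for j
    using that by simp
  with assms(2,1) show ?thesis
    by (induction rule: cover.induct) (auto simp: cells_def image_iff)
qed

lemma pair_graph_moore_graph:
  assumes "r \<ge> 1"
  shows "pair_graph (moore_graph k)"
proof
  have sub: "parcs (moore_graph k) \<subseteq> pverts (moore_graph k) \<times> pverts (moore_graph k)"
    using cover_cells[OF assms] by (auto simp: moore_graph_def)
  then show "e \<in> parcs (moore_graph k) \<Longrightarrow> fst e \<in> pverts (moore_graph k)"
    "e \<in> parcs (moore_graph k) \<Longrightarrow> snd e \<in> pverts (moore_graph k)" for e
    by (auto simp: mem_Times_iff)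
  show fin: "finite (pverts (moore_graph k))"
    by (simp add: moore_graph_def finite_cells)
  then show "finite (parcs (moore_graph k))"
    using sub by (blast intro: finite_subset)
  show "symmetric (with_proj (moore_graph k))"
    by (auto simp: symmetric_def moore_graph_def intro!: symI)
  show "e \<in> parcs (moore_graph k) \<Longrightarrow> fst e \<noteq> snd e" for e
    using rank_cover by (fastforce simp: moore_graph_def)
qed

lemma layered_graph_moore_graph:
  assumes "r \<ge> 1"
  shows "layered_graph (moore_graph k) (\<lambda>v. int (rank (from_nat v))) (to_nat Source) (to_nat Sink) (r + 3)"
proof -
  interpret pair_graph "moore_graph k" by (rule pair_graph_moore_graph[OF assms])
  show ?thesis
  proof
    show "\<bar>int (rank (from_nat v)) - int (rank (from_nat u))\<bar> = 1"
      if "(u, v) \<in> parcs (moore_graph k)" for u v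
      using that rank_cover by (fastforce simp: moore_graph_def)
  qed (auto simp: moore_graph_def cells_def)
qed

lemma up_moore_graph:
  assumes "r \<ge> 1"
  shows "layered_graph.up (moore_graph k) (\<lambda>v. int (rank (from_nat v))) =
    {(to_nat x, to_nat y) | x y. cover x y}"
proof -
  interpret layered_graph "moore_graph k" "\<lambda>v. int (rank (from_nat v))" "to_nat Source" "to_nat Sink" "r + 3"
    by (rule layered_graph_moore_graph[OF assms])
  show ?thesis
    unfolding up_def by (auto simp: moore_graph_def dest: rank_cover)
qed

lemma trancl_up_moore_graph:
  assumes "r \<ge> 1"
  shows "(to_nat x, v) \<in> (layered_graph.up (moore_graph k) (\<lambda>v. int (rank (from_nat v))))\<^sup>+ \<longleftrightarrow>
    (\<exists>y. v = to_nat y \<and> cover\<^sup>+\<^sup>+ x y)" (is "?L \<longleftrightarrow> ?R")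
proof
  assume ?L
  then show ?R
  proof (induction rule: trancl_induct)
    case (base v)
    then show ?case by (auto simp: up_moore_graph[OF assms])
  next
    case (step v w)
    then show ?case
      by (auto simp: up_moore_graph[OF assms] intro: tranclp.trancl_into_trancl)
  qed
next
  have "(to_nat x, to_nat y) \<in> (layered_graph.up (moore_graph k) (\<lambda>v. int (rank (from_nat v))))\<^sup>+"
    if "cover\<^sup>+\<^sup>+ x y" for y
    using that
  proof (induction rule: tranclp_induct)
    case (base y)
    then show ?case by (intro r_into_trancl) (auto simp: up_moore_graph[OF assms])
  next
    case (step y z)
    then show ?case
      by (intro trancl_into_trancl[OF step.IH]) (auto simp: up_moore_graph[OF assms])
  qed
  then show "?R \<Longrightarrow> ?L" by blast
qed

text \<open>This and the next three lemmas bound what lies strictly below each kind of cell.\<close>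

lemma tranclp_cover_Leg:
  assumes "cover\<^sup>+\<^sup>+ x (Leg c i)"
  shows "x = Source \<or> (\<exists>i'. x = Leg c i')"
proof -
  \<comment> \<open>The first conjunct makes the induction pass the foot of a leg, where the last
    step starts at \<open>Source\<close>.\<close>
  have "y \<noteq> Source \<and> (\<forall>c i. y = Leg c i \<longrightarrow> x = Source \<or> (\<exists>i'. x = Leg c i'))"
    if "cover\<^sup>+\<^sup>+ x y" for y
    using that by (induction rule: tranclp_induct) (auto elim!: cover.cases)
  then show ?thesis using assms by blast
qed

lemma tranclp_cover_Arc:
  assumes "cover\<^sup>+\<^sup>+ x (Arc d)"
  shows "x = Source \<or> (\<exists>c i. c < 2 \<and> x = Leg c i)"
  using assms by (cases rule: tranclp.cases) (auto elim!: cover.cases dest!: tranclp_cover_Leg)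

lemma tranclp_cover_Spoke:
  assumes "cover\<^sup>+\<^sup>+ x (Spoke j)"
  shows "x = Source \<or> (\<exists>c i. (c = 2 \<or> c = j mod 2) \<and> x = Leg c i)"
  using assms by (cases rule: tranclp.cases) (auto elim!: cover.cases dest!: tranclp_cover_Leg)

lemma tranclp_cover_Tri:
  assumes "cover\<^sup>+\<^sup>+ x (Tri j)"
  shows "j < 2 * N \<and> (x = Source \<or> x = Arc (j mod 2) \<or> x = Spoke j \<or> x = Spoke (Suc j mod (2 * N))
    \<or> (\<exists>c i. x = Leg c i))"
  using assms
  by (cases rule: tranclp.cases)
     (auto elim!: cover.cases dest!: tranclp_cover_Arc tranclp_cover_Spoke)

text \<open>
  The cochain that counts, modulo \<open>N\<close>, how often a loop winds around the circle. It is normalised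
  to vanish on all pairs above \<open>Leg 1\<close>, on \<open>Arc < Tri\<close>, on \<open>Leg (j mod 2) < Spoke j\<close> and on
  \<open>Spoke j < Tri j\<close>; the values on \<open>Leg 2 < Spoke j\<close> are then forced to go up by one with every turn
  of the polygon, so that closing up after \<open>N\<close> turns is only consistent modulo \<open>N\<close>.
\<close>

fun winding :: "cell \<Rightarrow> cell \<Rightarrow> int" where
  "winding (Leg c i) (Arc d) = (if c = 0 then - int d else 0)"
| "winding (Leg c i) (Spoke j) = (if c = 2 then int (j div 2) else 0)"
| "winding (Leg c i) (Tri j) = (if c = 0 then - int (j mod 2) else if c = 2 then int (j div 2) else 0)"
| "winding (Spoke i) (Tri j) = (if odd j \<and> i = Suc j mod (2 * N) then -1 else 0)"
| "winding _ _ = 0"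

lemma winding_cocycle:
  assumes "cover\<^sup>+\<^sup>+ Source w" "cover\<^sup>+\<^sup>+ w x" "cover\<^sup>+\<^sup>+ x y" "cover\<^sup>+\<^sup>+ y Sink"
  shows "int N dvd winding w x + winding x y - winding w y"
proof -
  have rank: "rank u < rank v" if "cover\<^sup>+\<^sup>+ u v" for u v
    using that by (induction rule: tranclp_induct) (auto dest!: rank_cover)
  have w: "w \<noteq> Source" and y: "y \<noteq> Sink"
    using rank[OF assms(1)] rank[OF assms(4)] by auto
  have x: "x \<noteq> Source" using rank[OF assms(2)] by auto
  show ?thesis
  proof (cases y)
    \<comment> \<open>For \<open>y\<close> a leg vertex, arc or spoke, \<open>w\<close> and
      \<open>x\<close> lie on one leg: \<open>winding w x\<close> is 0 and the values towards
      \<open>y\<close> agree.\<close>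
    case (Leg c i)
    then show ?thesis using assms(2,3) w x by (auto dest!: tranclp_cover_Leg)
  next
    case (Arc d)
    then show ?thesis using assms(2,3) w x by (auto dest!: tranclp_cover_Arc tranclp_cover_Leg)
  next
    case (Spoke j)
    then show ?thesis using assms(2,3) w x by (auto dest!: tranclp_cover_Spoke tranclp_cover_Leg)
  next
    case (Tri j)
    have j: "j < 2 * N" using assms(3) tranclp_cover_Tri Tri by blast
    from Tri consider "x = Arc (j mod 2)" | "x = Spoke j" | "x = Spoke (Suc j mod (2 * N))"
      | c i where "x = Leg c i"
      using tranclp_cover_Tri assms(3) x by blast
    then show ?thesis
    proof cases
      case 1
      then show ?thesis using assms(2) w Tri by (auto dest!: tranclp_cover_Arc)
    next
      case 2
      \<comment> \<open>The two spokes of a triangle differ, so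
        \<open>winding (Spoke j) (Tri j)\<close> is 0.\<close>
      have "j \<noteq> Suc j mod (2 * N)"
      proof (cases "Suc j = 2 * N")
        case True
        then have "j \<noteq> 0" by presburger
        then show ?thesis using True by simp
      qed (use j in simp)
      then show ?thesis
        using 2 assms(2) w Tri by (auto dest!: tranclp_cover_Spoke simp: mod2_eq_if split: if_splits)
    next
      case 3
      let ?i = "Suc j mod (2 * N)"
      have mod2: "?i mod 2 = Suc j mod 2" by (simp add: mod_mod_cancel)
      \<comment> \<open>This is the coboundary for \<open>w\<close> on the central leg: 0 except at
        \<open>j = 2 * N - 1\<close>, where the spoke index falls back to 0 and the value is
        \<open>- int N\<close>.\<close>
      have step: "int N dvd int (?i div 2) - int (j mod 2) - int (j div 2)"
      proof (cases "Suc j = 2 * N")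
        case True
        then obtain M where "N = Suc M" "j = Suc (2 * M)" by (cases N) auto
        then have "int (?i div 2) - int (j mod 2) - int (j div 2) = - int N" by simp
        then show ?thesis by (simp only: dvd_minus_iff dvd_refl)
      next
        case False
        then have "?i = Suc j" using j by simp
        moreover have "Suc j div 2 = j div 2 + j mod 2" by presburger
        ultimately show ?thesis by simp
      qed
      from assms(2) w 3 obtain c i where "w = Leg c i" "c = 2 \<or> c = Suc j mod 2"
        using mod2 by (auto dest!: tranclp_cover_Spoke)
      then show ?thesis
        using 3 Tri step by (auto simp: mod2_eq_if split: if_splits)
    next
      case 4
      then show ?thesis using assms(2) w Tri by (auto dest!: tranclp_cover_Leg)
    qed
  next
    case Source
    then show ?thesis using rank[OF assms(3)] by simp
  next
    case (Extra i)
    then show ?thesis using rank[OF assms(3)] by simp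
  qed (use y in simp)
qed

end

section \<open>The circle, the disc and its boundary\<close>

lemma sum_Suc_mod: "(\<Sum>j<m. f (Suc j mod m)) = (\<Sum>j<m. f j)"
proof (cases m)
  case (Suc n)
  have "(\<Sum>j<Suc n. f (Suc j mod Suc n)) = (\<Sum>j<n. f (Suc j)) + f 0"
    by simp
  also have "\<dots> = (\<Sum>j<Suc n. f j)"
    by (subst sum.lessThan_Suc_shift) (simp add: add.commute)
  finally show ?thesis using Suc by simp
qed simp

lemma sum_mod_2: "(\<Sum>j<2 * N. f (j mod 2)) = frag_cmul (int N) (f 0 + f 1)"
  for f :: "nat \<Rightarrow> 'a \<Rightarrow>\<^sub>0 int"
  by (induction N) (simp_all add: frag_cmul_distrib frag_cmul_distrib2 add_ac)

lemma MH_moore_graph: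
  assumes N: "N \<ge> 1" and r: "r \<ge> 1"
  shows "\<exists>T. subgroup T (MH (moore_graph N r k) 3 (r + 3)) \<and>
    (MH (moore_graph N r k) 3 (r + 3))\<lparr>carrier := T\<rparr> \<cong> integer_mod_group N"
proof -
  let ?G = "moore_graph N r k"
  let ?src = "to_nat Source" and ?snk = "to_nat Sink"
  interpret layered_graph ?G "\<lambda>v. int (rank r (from_nat v))" ?src ?snk "r + 3"
    by (rule layered_graph_moore_graph[OF r])
  note trancl_up = trancl_up_moore_graph[OF r]
  let ?below = "\<lambda>x y. (cover N r)\<^sup>+\<^sup>+ x y"
  have Source_Leg: "?below Source (Leg c (Suc i))" if "c < 3" "i < r" for c i
    using that(2)
  proof (induction i)
    case 0
    then show ?case using cover.intros(1)[OF that(1)] by auto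
  next
    case (Suc i)
    then show ?case
      using cover.intros(2)[OF that(1), of "Suc i" r N] by (auto intro: tranclp.trancl_into_trancl)
  qed
  have leg: "?below Source (Leg c r)" if "c < 3" for c
    using Source_Leg[OF that, of "r - 1"] r by simp
  define wrap where "wrap xs = frag_of (?src # map to_nat xs @ [?snk])" for xs :: "cell list"
  \<comment> \<open>Indices are reduced inside these definitions, so \<open>Suc j\<close> also makes
    sense in the last sector.\<close>
  define v where "v j = Leg (j mod 2) r" for j :: nat
  define e where "e j = Arc (j mod 2)" for j :: nat
  define s where "s j = Spoke (j mod (2 * N))" for j
  define b where "b = Leg 2 r"
  have mod2: "j mod (2 * N) mod 2 = j mod 2" for j :: nat
    by (simp add: mod_mod_cancel)
  have below_Sink: "?below (Tri j) Sink" if "j < 2 * N" for j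
    using cover.intros(9)[OF that] by auto
  have v: "?below Source (v j)" and b: "?below Source b" for j
    by (auto simp: v_def b_def intro!: leg)
  have v_e: "?below (v i) (e j)" for i j
    by (auto simp: v_def e_def intro!: tranclp.r_into_trancl cover.intros(3))
  have s_lt: "j mod (2 * N) < 2 * N" for j using N by simp
  have v_s: "?below (v j) (s j)" and b_s: "?below b (s j)" for j
    using cover.intros(4)[OF s_lt, of r j] cover.intros(5)[OF s_lt, of r j]
    by (auto simp: v_def s_def b_def mod2)
  have e_t: "?below (e j) (Tri j)" and s_t: "?below (s j) (Tri j)" and s'_t: "?below (s (Suc j)) (Tri j)"
    if "j < 2 * N" for j
  proof -
    have "s j = Spoke j" "s (Suc j) = Spoke (Suc j mod (2 * N))"
      using that by (simp_all add: s_def)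
    then show "?below (e j) (Tri j)" "?below (s j) (Tri j)" "?below (s (Suc j)) (Tri j)"
      using cover.intros(6-8)[OF that, of r] by (auto simp: e_def)
  qed

  \<comment> \<open>The \<open>j\<close>-th edge, subdivided at its midpoint \<open>e j\<close>; two
    such edges close up to the circle.\<close>
  let ?rim = "\<lambda>j. wrap [v j, e j] - wrap [v (Suc j), e j]"
  let ?z0 = "?rim 0 + ?rim 1"
  let ?S = "\<lambda>j. wrap [v j, s j] - wrap [b, s j]"
  \<comment> \<open>The sector of the disc over the \<open>j\<close>-th edge of the polygon. Its boundary consists of that edge
    and the two radii \<open>?S j\<close>, \<open>?S (Suc j)\<close>, which cancel in the sum over all sectors.\<close>
  let ?D = "\<lambda>j. wrap [v (Suc j), e j, Tri j] - wrap [v j, e j, Tri j]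
    + wrap [v j, s j, Tri j] - wrap [v (Suc j), s (Suc j), Tri j]
    + wrap [b, s (Suc j), Tri j] - wrap [b, s j, Tri j]"
  have e_Sink: "?below (e j) Sink" for j
  proof -
    have "j mod 2 < 2 * N" by (rule less_le_trans[of _ 2]) (use N in simp_all)
    from tranclp_trans[OF e_t[OF this] below_Sink[OF this]] show ?thesis
      by (simp add: e_def)
  qed
  have d3: "mag_diff ?G 3 (r + 3) (wrap [x, y]) = wrap [x] - wrap [y]"
    and k3: "Poly_Mapping.keys (wrap [x, y]) \<subseteq> k_paths_of_length ?G 3 (r + 3)"
    if "?below Source x" "?below x y" "?below y Sink" for x y
    using that by (auto simp: wrap_def mag_diff_3 geodesic_3_iff trancl_up)
  have d4: "mag_diff ?G 4 (r + 3) (wrap [x, y, t]) = wrap [x, t] - wrap [y, t] - wrap [x, y]"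
    and k4: "Poly_Mapping.keys (wrap [x, y, t]) \<subseteq> k_paths_of_length ?G 4 (r + 3)"
    if "?below Source x" "?below x y" "?below y t" "?below t Sink" for x y t
    using that by (auto simp: wrap_def mag_diff_4 geodesic_4_iff trancl_up)
  \<comment> \<open>Each face containing \<open>Tri j\<close> occurs twice, with opposite
    signs.\<close>
  have d_D: "mag_diff ?G 4 (r + 3) (?D j) = ?rim j + ?S (Suc j) - ?S j" if "j < 2 * N" for j
    by (simp add: mag_diff_add mag_diff_diff d4 v b v_e v_s b_s e_t[OF that] s_t[OF that] s'_t[OF that]
        below_Sink[OF that])
  let ?c = "\<Sum>j<2 * N. ?D j"
  let ?\<phi> = "\<lambda>xs. if length xs = 4 \<and> xs ! 0 = ?src \<and> xs ! 3 = ?snk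
    then winding N (from_nat (xs ! 1)) (from_nat (xs ! 2)) else 0"
  show ?thesis
  proof (rule MH_torsion[where z = ?z0 and c = ?c and \<phi> = ?\<phi>])
    have "Poly_Mapping.keys ?z0 \<subseteq> k_paths_of_length ?G 3 (r + 3)"
      by (intro keys_frag_add_subset keys_frag_diff_subset k3 v v_e e_Sink)
    moreover have "mag_diff ?G 3 (r + 3) ?z0 = 0"
      by (simp only: mag_diff_add mag_diff_diff d3 v v_e e_Sink) (simp add: v_def)
    ultimately show "?z0 \<in> mag_cycles ?G 3 (r + 3)"
      by (simp add: mag_cycles_def MC_def)
    have "Poly_Mapping.keys ?c \<subseteq> k_paths_of_length ?G 4 (r + 3)"
      by (intro keys_frag_sum_subset keys_frag_add_subset keys_frag_diff_subset k4 v b v_e v_s b_s e_t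
          s_t s'_t below_Sink) simp_all
    then show "?c \<in> carrier (MC ?G (Suc 3) (r + 3))"
      by (simp add: MC_def)
    have "mag_diff ?G 4 (r + 3) ?c = (\<Sum>j<2 * N. ?rim j + ?S (Suc j) - ?S j)"
      unfolding mag_diff_sum[OF finite_lessThan] by (intro sum.cong refl d_D) simp
    also have "\<dots> = (\<Sum>j<2 * N. ?rim j) + ((\<Sum>j<2 * N. ?S (Suc j)) - (\<Sum>j<2 * N. ?S j))"
      by (simp only: sum.distrib sum_subtractf add_diff_eq)
    also have "(\<Sum>j<2 * N. ?S (Suc j)) = (\<Sum>j<2 * N. ?S (Suc j mod (2 * N)))"
      by (simp add: v_def s_def mod2)
    also have "\<dots> = (\<Sum>j<2 * N. ?S j)"
      by (rule sum_Suc_mod)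
    \<comment> \<open>Edges depend only on the parity of \<open>j\<close>, so the rim runs
      \<open>N\<close> times around the circle.\<close>
    also have "(\<Sum>j<2 * N. ?rim j) = (\<Sum>j<2 * N. ?rim (j mod 2))"
      by (simp add: v_def e_def mod_Suc_eq)
    also have "\<dots> = frag_cmul (int N) ?z0"
      by (rule sum_mod_2)
    finally show "mag_diff ?G (Suc 3) (r + 3) ?c = frag_cmul (int N) ?z0"
      by simp
    show "int N dvd frag_eval ?\<phi> (mag_diff ?G (Suc 3) (r + 3) (frag_of xs))"
      if "xs \<in> k_paths_of_length ?G (Suc 3) (r + 3)" for xs
    proof -
      have "int N dvd frag_eval ?\<phi> (mag_diff ?G 4 (r + 3) (frag_of xs))"
      proof (rule cocycle_dvd[where \<psi> = "\<lambda>x y. winding N (from_nat x) (from_nat y)"])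
        fix w x y
        assume "(?src, w) \<in> up\<^sup>+" "(w, x) \<in> up\<^sup>+" "(x, y) \<in> up\<^sup>+" "(y, ?snk) \<in> up\<^sup>+"
        then show "int N dvd winding N (from_nat w) (from_nat x) + winding N (from_nat x) (from_nat y)
            - winding N (from_nat w) (from_nat y)"
          by (auto simp: trancl_up intro!: winding_cocycle)
      qed (use that in simp_all)
      then show ?thesis by simp
    qed
    \<comment> \<open>Only \<open>wrap [v 2, e 1]\<close> contributes: coefficient -1 times the
      winding -1 of \<open>Leg 0 r\<close> below \<open>Arc 1\<close>.\<close>
    show "frag_eval ?\<phi> ?z0 = 1"
      by (simp add: wrap_def v_def e_def)
  qed (use N in simp)
qed

section \<open>Infinitely many isomorphism types\<close>

lemma card_verts_moore_graph: "card (pverts (moore_graph N r k)) = card (cells N r) + k"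
proof -
  have "card (pverts (moore_graph N r k)) = card (cells N r \<union> Extra ` {..<k})"
    by (simp add: moore_graph_def card_image inj_on_subset[OF inj_to_nat])
  also have "\<dots> = card (cells N r) + card (Extra ` {..<k})"
    by (rule card_Un_disjoint) (auto simp: finite_cells, auto simp: cells_def)
  also have "card (Extra ` {..<k}) = k"
    by (simp add: card_image inj_on_def)
  finally show ?thesis .
qed

lemma graph_iso_card_verts: "graph_iso G H \<Longrightarrow> card (pverts G) = card (pverts H)"
  unfolding graph_iso_def digraph_iso_def
  by (force simp: pre_digraph.digraph_isomorphism_def card_image verts_app_iso
      dest: arg_cong[where f = verts])

theorem theorem3p13:
  fixes p n m :: nat
  assumes "prime p" and "n \<ge> 1" and "m \<ge> 1"
  shows "\<exists>\<G> :: nat pair_pre_digraph set.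
    infinite \<G> \<and> pairwise (\<lambda>G H. \<not> graph_iso G H) \<G> \<and>
    (\<forall>G\<in>\<G>. pair_graph G \<and>
      (\<exists>T. subgroup T (MH G 3 (2 * n + 3)) \<and>
           (MH G 3 (2 * n + 3))\<lparr>carrier := T\<rparr> \<cong> integer_mod_group (p ^ m)))"
proof -
  \<comment> \<open>Legs of length \<open>2 * n\<close> put \<open>Sink\<close> at level
    \<open>2 * n + 3\<close>.\<close>
  let ?G = "moore_graph (p ^ m) (2 * n)"
  have "inj ?G"
    by (rule injI) (metis add_left_cancel card_verts_moore_graph)
  then have "infinite (range ?G)"
    by (rule range_inj_infinite)
  moreover have "pairwise (\<lambda>G H. \<not> graph_iso G H) (range ?G)"
  proof -
    have "i = j" if "graph_iso (?G i) (?G j)" for i j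
      using graph_iso_card_verts[OF that] by (simp add: card_verts_moore_graph)
    then show ?thesis by (auto simp: pairwise_def)
  qed
  moreover have "pair_graph (?G k)" for k
    using assms(2) by (intro pair_graph_moore_graph) simp
  moreover have "\<exists>T. subgroup T (MH (?G k) 3 (2 * n + 3)) \<and>
      (MH (?G k) 3 (2 * n + 3))\<lparr>carrier := T\<rparr> \<cong> integer_mod_group (p ^ m)" for k
    using assms prime_gt_0_nat[OF assms(1)] by (intro MH_moore_graph) (simp_all add: Suc_le_eq)
  ultimately show ?thesis by (intro exI[of _ "range ?G"]) blast
qed

end
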